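(* Let $\mathbf{B}$ be the bilinear map on $\mathbf{FQSym}$ defined, for $\alpha\in\mathfrak{S}_k$, $\beta\in\mathfrak{S}_l$ and $n=k+l$, by $$\mathbf{B}(\mathbf{G}_\alpha,\mathbf{G}_\beta)=\sum_{\gamma}\mathbf{G}_\gamma,$$ the sum running over all $\gamma\in\mathfrak{S}_{n+1}$ whose word has the form $\gamma=u\,(n+1)\,v$ with $\mathrm{Std}(u)=\alpha$, $\mathrm{Std}(v)=\beta$. For a complete binary tree $T$, define $\mathbf{B}_T(1)\in\mathbf{FQSym}$ recursively: if $T$ is a single leaf, $\mathbf{B}_T(1)=1$; otherwise, if $T'$ and $T''$ are the left and right subtrees of the root of $T$, $\mathbf{B}_T(1)=\mathbf{B}(\mathbf{B}_{T'}(1),\mathbf{B}_{T''}(1))$ (so that $\mathbf{X}=\sum_T\mathbf{B}_T(1)$ is the solution of $\mathbf{X}=1+\mathbf{B}(\mathbf{X},\mathbf{X})$). Then for every complete binary tree $T$ with $n$ internal nodes, $$\mathbf{B}_T(1)=\sum_{\sigma\in\mathfrak{S}_n,\ \mathcal{T}(\sigma)=T}\mathbf{G}_\sigma,$$ where $\mathcal{T}(\sigma)$ is the shape of the decreasing tree of $\sigma$ (identifying the complete binary tree $T$ with the incomplete binary tree formed by its internal nodes). In particular, $\mathbf{B}_T(1)$ coincides with the basis element $\mathbf{P}_T$ of the Loday–Ronco algebra of planar binary trees, realized inside $\mathbf{FQSym}$ as $\mathbf{P}_T=\sum_{\mathcal{T}(\sigma)=T}\mathbf{G}_\sigma$.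
   Context: $\mathbb{K}$ is a field of characteristic $0$, $A$ an infinite totally ordered alphabet. The standardization $\mathrm{Std}(w)$ of a word $w$ of length $n$ is the permutation of $\mathfrak{S}_n$ obtained by scanning $w$ from left to right, labelling $1,2,\ldots$ the occurrences of its smallest letter, then those of the next smallest letter, and so on. For $\sigma\in\mathfrak{S}_n$, $\mathbf{G}_\sigma=\sum_{w\in A^n,\mathrm{Std}(w)=\sigma}w$, with $\mathbf{G}_\varepsilon=1$ for the empty permutation; $\mathbf{FQSym}$ is the algebra spanned by these. The decreasing tree of a word $w$ with distinct letters is defined recursively: the empty word gives the empty tree; otherwise write $w=u\,m\,v$ with $m$ the maximal letter, and the decreasing tree is the binary tree with root labeled $m$, left subtree the decreasing tree of $u$ and right subtree the decreasing tree of $v$. Its shape is the underlying unlabeled (incomplete) binary tree with $n$ nodes. A complete binary tree (each internal node has exactly two children) with $n$ internal nodes is identified with the incomplete binary tree with $n$ nodes obtained by deleting its leaves. *)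

theory Defs
  imports
    Complex_Main
    "HOL-Library.Tree"
    "HOL-Library.Function_Algebras"
    "HOL-Library.Groups_Big_Fun"
    "HOL-Library.Infinite_Typeclass"
    "HOL-Combinatorics.Multiset_Permutations"
begin

section \<open>Permutations, standardization, decreasing trees\<close>

text \<open>Permutations are written in one-line notation, as words over the positive integers.\<close>

definition perms :: "nat \<Rightarrow> nat list set" where
  "perms n = permutations_of_set {1..n}"

definition all_perms :: "nat list set" where
  "all_perms = (\<Union>n. perms n)"

text \<open>The scan labels position \<open>j\<close> before position \<open>i\<close> iff the letter at \<open>j\<close> is smaller, or
  it is the same letter and \<open>j\<close> lies to the left of \<open>i\<close>.\<close>

definition std :: "'a::linorder list \<Rightarrow> nat list" where
  "std w = map (\<lambda>i. 1 + card {j. j < length w \<and> (w ! j < w ! i \<or> w ! j = w ! i \<and> j < i)})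
             [0..<length w]"

text \<open>For words with distinct letters, \<open>takeWhile\<close> and \<open>tl \<circ> dropWhile\<close> give the factors
  \<open>u\<close> and \<open>v\<close> of \<open>w = u m v\<close>.\<close>

function dec_tree :: "'a::linorder list \<Rightarrow> 'a tree" where
  "dec_tree w = (if w = [] then Leaf else
     (let m = Max (set w) in
      Node (dec_tree (takeWhile (\<lambda>x. x \<noteq> m) w)) m (dec_tree (tl (dropWhile (\<lambda>x. x \<noteq> m) w)))))"
  by auto
termination
proof (relation "measure length", goal_cases)
  case 1
  then show ?case by simp
next
  case (2 w m)
  then have "m \<in> set w" by simp
  then have "dropWhile (\<lambda>x. x \<noteq> m) w \<noteq> []" by simp
  then have "length (takeWhile (\<lambda>x. x \<noteq> m) w) < length (takeWhile (\<lambda>x. x \<noteq> m) w @ dropWhile (\<lambda>x. x \<noteq> m) w)"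
    by (simp only: length_append length_greater_0_conv less_add_same_cancel1 not_False_eq_True)
  then show ?case by simp
next
  case (3 w m)
  have "length (dropWhile (\<lambda>x. x \<noteq> m) w) \<le> length w" by (rule length_dropWhile_le)
  moreover have "length w > 0" using 3 by simp
  ultimately have "length (tl (dropWhile (\<lambda>x. x \<noteq> m) w)) < length w"
    unfolding length_tl by linarith
  then show ?case by simp
qed

declare dec_tree.simps [simp del]

text \<open>An incomplete binary tree is a \<open>unit tree\<close>; there \<open>Leaf\<close> is the empty tree and
  \<open>size\<close> is the number of nodes.\<close>

definition shape :: "'a tree \<Rightarrow> unit tree" where
  "shape t = map_tree (\<lambda>_. ()) t"

datatype complete_tree = CLeaf | CNode complete_tree complete_tree

primrec internal_nodes :: "complete_tree \<Rightarrow> nat" where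
  "internal_nodes CLeaf = 0"
| "internal_nodes (CNode T' T'') = internal_nodes T' + internal_nodes T'' + 1"

primrec delete_leaves :: "complete_tree \<Rightarrow> unit tree" where
  "delete_leaves CLeaf = Leaf"
| "delete_leaves (CNode T' T'') = Node (delete_leaves T') () (delete_leaves T'')"

section \<open>FQSym inside the noncommutative formal series\<close>

text \<open>A formal series over the alphabet \<open>'a\<close> is its coefficient function. Addition is the
  pointwise one of \<open>Function_Algebras\<close>; the pointwise product and the constant function
  \<open>1\<close> of that theory are not the product and unit of series and are not used.\<close>

type_synonym ('a, 'k) series = "'a list \<Rightarrow> 'k"

definition ser_scale :: "'k::field \<Rightarrow> ('a, 'k) series \<Rightarrow> ('a, 'k) series" where
  "ser_scale c f = (\<lambda>w. c * f w)"

global_interpretation ser: vector_space "ser_scale :: 'k::field \<Rightarrow> ('a, 'k) series \<Rightarrow> ('a, 'k) series"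
  by standard (auto simp: ser_scale_def fun_eq_iff algebra_simps)

definition ser_one :: "('a, 'k::field) series" where
  "ser_one = (\<lambda>w. if w = [] then 1 else 0)"

definition fqG :: "nat list \<Rightarrow> ('a::linorder, 'k::field) series" where
  "fqG \<sigma> = (\<lambda>w. if length w = length \<sigma> \<and> std w = \<sigma> then 1 else 0)"

definition fqsym :: "('a::linorder, 'k::field) series set" where
  "fqsym = ser.span (fqG ` all_perms)"

lemma fqG_Nil: "fqG [] = ser_one"
  by (auto simp: fqG_def ser_one_def std_def fun_eq_iff)

text \<open>The coordinate of an element of \<open>fqsym\<close> on \<open>fqG \<sigma>\<close>. The family \<open>fqG\<close> is linearly
  independent because the alphabet is infinite (see below).\<close>

definition fq_coord :: "('a::{linorder,infinite}, 'k::field) series \<Rightarrow> nat list \<Rightarrow> 'k" where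
  "fq_coord f \<sigma> = ser.representation (fqG ` all_perms) f (fqG \<sigma>)"

section \<open>The bilinear map B\<close>

definition fqB_basis :: "nat list \<Rightarrow> nat list \<Rightarrow> ('a::{linorder,infinite}, 'k::field) series" where
  "fqB_basis \<alpha> \<beta> = (let n = length \<alpha> + length \<beta> in
     \<Sum>\<gamma> | \<gamma> \<in> perms (n + 1) \<and> (\<exists>u v. \<gamma> = u @ [n + 1] @ v \<and> std u = \<alpha> \<and> std v = \<beta>). fqG \<gamma>)"

text \<open>The bilinear extension of \<open>fqB_basis\<close> to \<open>fqsym\<close>; the sums range over the finite sets of
  nonzero coordinates. The lemmas \<open>fqB_fqG\<close>, \<open>fqB_closed\<close> and \<open>fqB_add_left\<close> to
  \<open>fqB_scale_right\<close> below give its characteristic properties.\<close>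

definition fqB :: "('a::{linorder,infinite}, 'k::field) series \<Rightarrow> ('a, 'k) series \<Rightarrow> ('a, 'k) series" where
  "fqB f g = (\<Sum>\<alpha> | \<alpha> \<in> all_perms \<and> fq_coord f \<alpha> \<noteq> 0.
                \<Sum>\<beta> | \<beta> \<in> all_perms \<and> fq_coord g \<beta> \<noteq> 0.
                  ser_scale (fq_coord f \<alpha> * fq_coord g \<beta>) (fqB_basis \<alpha> \<beta>))"

primrec B_tree :: "complete_tree \<Rightarrow> ('a::{linorder,infinite}, 'k::field) series" where
  "B_tree CLeaf = ser_one"
| "B_tree (CNode T' T'') = fqB (B_tree T') (B_tree T'')"

definition P_tree :: "unit tree \<Rightarrow> ('a::linorder, 'k::field) series" where
  "P_tree t = (\<Sum>\<sigma> | \<sigma> \<in> perms (size t) \<and> shape (dec_tree \<sigma>) = t. fqG \<sigma>)"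

section \<open>The equation X = 1 + B(X,X) in the completion of FQSym\<close>

text \<open>\<open>X\<close> has components of every degree, so it lives in the completion of \<open>fqsym\<close> with
  respect to the degree, and \<open>B\<close> is extended there degree by degree: as \<open>B\<close> maps degrees
  \<open>(k, l)\<close> to degree \<open>k + l + 1\<close>, only finitely many terms contribute to each coefficient.\<close>

definition ser_hom :: "nat \<Rightarrow> ('a, 'k::field) series \<Rightarrow> ('a, 'k) series" where
  "ser_hom k f = (\<lambda>w. if length w = k then f w else 0)"

definition fqsym_completion :: "('a::linorder, 'k::field) series set" where
  "fqsym_completion = {f. \<forall>k. ser_hom k f \<in> fqsym}"

definition fqB_completion ::
    "('a::{linorder,infinite}, 'k::field) series \<Rightarrow> ('a, 'k) series \<Rightarrow> ('a, 'k) series" where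
  "fqB_completion f g =
     (\<lambda>w. \<Sum>(k, l) | k + l + 1 = length w. fqB (ser_hom k f) (ser_hom l g) w)"

text \<open>\<open>Sum_any\<close> is the sum of a family with finite support.\<close>

definition X_series :: "('a::{linorder,infinite}, 'k::field) series" where
  "X_series = (\<lambda>w. Sum_any (\<lambda>T. B_tree T w))"

section \<open>Linear independence of the G's, and characteristic properties of B\<close>

lemma length_std [simp]: "length (std w) = length w"
  by (simp add: std_def)

lemma std_nth: "i < length w \<Longrightarrow>
  std w ! i = 1 + card {j. j < length w \<and> (w ! j < w ! i \<or> w ! j = w ! i \<and> j < i)}"
  by (simp add: std_def)

lemma all_permsD:
  assumes "\<sigma> \<in> all_perms"
  shows "distinct \<sigma>" "set \<sigma> = {1..length \<sigma>}" "\<sigma> \<in> perms (length \<sigma>)"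
proof -
  obtain n where n: "\<sigma> \<in> permutations_of_set {1..n}"
    using assms by (auto simp: all_perms_def perms_def)
  then have "length \<sigma> = n" by (auto dest: length_finite_permutations_of_set)
  with n show "distinct \<sigma>" "set \<sigma> = {1..length \<sigma>}" "\<sigma> \<in> perms (length \<sigma>)"
    by (auto simp: permutations_of_set_def perms_def)
qed

lemma std_perm:
  assumes "\<sigma> \<in> all_perms"
  shows "std \<sigma> = \<sigma>"
proof (rule nth_equalityI)
  fix i assume "i < length (std \<sigma>)"
  then have i: "i < length \<sigma>" by simp
  note d = all_permsD(1,2)[OF assms]
  have "{j. j < length \<sigma> \<and> (\<sigma> ! j < \<sigma> ! i \<or> \<sigma> ! j = \<sigma> ! i \<and> j < i)}
      = {j. j < length \<sigma> \<and> \<sigma> ! j < \<sigma> ! i}" (is "_ = ?A")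
    using d(1) i by (auto simp: nth_eq_iff_index_eq)
  moreover have "card ?A = card ((!) \<sigma> ` ?A)"
    using d(1) by (intro card_image[symmetric]) (auto simp: inj_on_def nth_eq_iff_index_eq)
  moreover have "(!) \<sigma> ` ?A = {x \<in> set \<sigma>. x < \<sigma> ! i}"
    by (auto simp: in_set_conv_nth)
  moreover have "{x \<in> set \<sigma>. x < \<sigma> ! i} = {1..<\<sigma> ! i}"
    using d(2) i nth_mem[OF i] by auto
  moreover have "1 \<le> \<sigma> ! i" using d(2) nth_mem[OF i] by auto
  ultimately show "std \<sigma> ! i = \<sigma> ! i"
    using i by (simp add: std_nth)
qed simp

lemma std_map:
  assumes "strict_mono_on (set w) f"
  shows "std (map f w) = std w"
proof (rule nth_equalityI)
  fix i assume "i < length (std (map f w))"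
  then have i: "i < length w" by simp
  have "f x < f y \<longleftrightarrow> x < y" "f x = f y \<longleftrightarrow> x = y" if "x \<in> set w" "y \<in> set w" for x y
    using that assms by (auto simp: strict_mono_on_less strict_mono_on_eq)
  then show "std (map f w) ! i = std w ! i"
    using i by (auto simp: std_nth intro!: arg_cong[where f = card])
qed simp

lemma std_surj:
  assumes "\<sigma> \<in> all_perms"
  obtains w :: "'a::{linorder,infinite} list" where "std w = \<sigma>"
proof -
  obtain S :: "'a set" where S: "finite S" "card S = length \<sigma>"
    using infinite_arbitrarily_large[OF infinite_UNIV] by blast
  define xs where "xs = sorted_list_of_set S"
  have xs: "sorted_wrt (<) xs" "length xs = length \<sigma>"
    using S by (auto simp: xs_def)
  have "strict_mono_on (set \<sigma>) (\<lambda>i. xs ! (i - 1))"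
    using xs all_permsD(2)[OF assms]
    by (auto simp: strict_mono_on_def intro!: sorted_wrt_nth_less[of "(<)"])
  then have "std (map (\<lambda>i. xs ! (i - 1)) \<sigma>) = \<sigma>"
    using std_map std_perm[OF assms] by metis
  then show thesis by (rule that)
qed

lemma fqG_std: "std w = \<sigma> \<Longrightarrow> fqG \<tau> w = (if \<tau> = \<sigma> then 1 else (0::'k::field))"
  by (auto simp: fqG_def)

lemma inj_fqG: "inj_on (fqG :: _ \<Rightarrow> ('a::{linorder,infinite}, 'k::field) series) all_perms"
proof (rule inj_onI)
  fix \<sigma> \<tau> assume "\<sigma> \<in> all_perms" and eq: "(fqG \<sigma> :: ('a, 'k) series) = fqG \<tau>"
  then obtain w :: "'a list" where "std w = \<sigma>" by (metis std_surj)
  then have "(fqG \<sigma> :: ('a, 'k) series) w = 1" "(fqG \<tau> :: ('a, 'k) series) w = (if \<tau> = \<sigma> then 1 else 0)"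
    by (simp_all add: fqG_std)
  then show "\<sigma> = \<tau>" using eq by (metis zero_neq_one)
qed

lemma sum_fun_apply: "(\<Sum>i\<in>I. f i) x = (\<Sum>i\<in>I. f i x)"
  by (induction I rule: infinite_finite_induct) auto

lemma fqG_independent:
  "ser.independent (fqG ` all_perms :: ('a::{linorder,infinite}, 'k::field) series set)"
proof
  assume "ser.dependent (fqG ` all_perms :: ('a, 'k) series set)"
  then obtain t u b where t: "finite t" "t \<subseteq> (fqG ` all_perms :: ('a, 'k) series set)"
    "(\<Sum>v\<in>t. ser_scale (u v) v) = 0" "b \<in> t" "u b \<noteq> 0"
    by (auto simp: ser.dependent_explicit)
  then obtain \<sigma> where \<sigma>: "\<sigma> \<in> all_perms" "b = fqG \<sigma>" by blast
  obtain w :: "'a list" where w: "std w = \<sigma>" using std_surj[OF \<sigma>(1)] .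
  have "u v * v w = (if v = b then u b else 0)" if v: "v \<in> t" for v
  proof -
    obtain \<tau> where "\<tau> \<in> all_perms" "v = fqG \<tau>" using t v by blast
    then show ?thesis using \<sigma> by (cases "\<tau> = \<sigma>") (auto simp: fqG_std[OF w] dest: inj_onD[OF inj_fqG])
  qed
  then have "(\<Sum>v\<in>t. u v * v w) = u b"
    using t by (simp add: sum.delta)
  moreover have "(\<Sum>v\<in>t. u v * v w) = (\<Sum>v\<in>t. ser_scale (u v) v) w"
    by (simp add: sum_fun_apply ser_scale_def)
  ultimately show False using t by simp
qed

lemma fq_coord_fqG:
  "\<sigma> \<in> all_perms \<Longrightarrow> \<tau> \<in> all_perms \<Longrightarrow>
     fq_coord (fqG \<sigma> :: ('a::{linorder,infinite}, 'k::field) series) \<tau> = (if \<tau> = \<sigma> then 1 else 0)"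
  using inj_fqG[where 'a = 'a and 'k = 'k]
  by (auto simp: fq_coord_def ser.representation_basis[OF fqG_independent] inj_on_eq_iff)

lemma finite_fq_coord:
  "finite {\<sigma>. \<sigma> \<in> all_perms \<and> fq_coord (f :: ('a::{linorder,infinite}, 'k::field) series) \<sigma> \<noteq> 0}"
proof (rule finite_imageD)
  show "finite (fqG ` {\<sigma>. \<sigma> \<in> all_perms \<and> fq_coord f \<sigma> \<noteq> 0} :: ('a, 'k) series set)"
    by (rule finite_subset[OF _ ser.finite_representation[of "fqG ` all_perms" f]])
       (auto simp: fq_coord_def)
  show "inj_on (fqG :: _ \<Rightarrow> ('a, 'k) series) {\<sigma>. \<sigma> \<in> all_perms \<and> fq_coord f \<sigma> \<noteq> 0}"
    by (rule inj_on_subset[OF inj_fqG]) auto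
qed

lemma fq_coord_add:
  "f \<in> fqsym \<Longrightarrow> g \<in> fqsym \<Longrightarrow> fq_coord (f + g) \<sigma> = fq_coord f \<sigma> + fq_coord g \<sigma>"
  by (simp add: fq_coord_def fqsym_def ser.representation_add[OF fqG_independent])

lemma fq_coord_scale:
  "f \<in> fqsym \<Longrightarrow> fq_coord (ser_scale c f) \<sigma> = c * fq_coord f \<sigma>"
  by (simp add: fq_coord_def fqsym_def ser.representation_scale[OF fqG_independent])

lemma fqB_expand:
  assumes "finite S" "finite S'" "S \<subseteq> all_perms" "S' \<subseteq> all_perms"
    "{\<alpha>. \<alpha> \<in> all_perms \<and> fq_coord f \<alpha> \<noteq> 0} \<subseteq> S" "{\<beta>. \<beta> \<in> all_perms \<and> fq_coord g \<beta> \<noteq> 0} \<subseteq> S'"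
  shows "fqB f g = (\<Sum>\<alpha>\<in>S. \<Sum>\<beta>\<in>S'. ser_scale (fq_coord f \<alpha> * fq_coord g \<beta>) (fqB_basis \<alpha> \<beta>))"
proof -
  have "(\<Sum>\<alpha>\<in>S. \<Sum>\<beta>\<in>S'. ser_scale (fq_coord f \<alpha> * fq_coord g \<beta>) (fqB_basis \<alpha> \<beta>))
      = (\<Sum>\<alpha>\<in>S. \<Sum>\<beta> | \<beta> \<in> all_perms \<and> fq_coord g \<beta> \<noteq> 0.
           ser_scale (fq_coord f \<alpha> * fq_coord g \<beta>) (fqB_basis \<alpha> \<beta>))"
    using assms by (intro sum.cong refl sum.mono_neutral_right) auto
  also have "\<dots> = fqB f g"
    unfolding fqB_def using assms by (intro sum.mono_neutral_right) auto
  finally show ?thesis ..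
qed

lemma fqB_fqG:
  fixes \<alpha> \<beta> :: "nat list"
  assumes "\<alpha> \<in> all_perms" "\<beta> \<in> all_perms"
  shows "fqB (fqG \<alpha>) (fqG \<beta>) = (fqB_basis \<alpha> \<beta> :: ('a::{linorder,infinite}, 'k::field) series)"
proof -
  have "(fqB (fqG \<alpha>) (fqG \<beta>) :: ('a, 'k) series) = (\<Sum>\<alpha>'\<in>{\<alpha>}. \<Sum>\<beta>'\<in>{\<beta>}.
      ser_scale (fq_coord (fqG \<alpha> :: ('a, 'k) series) \<alpha>' * fq_coord (fqG \<beta> :: ('a, 'k) series) \<beta>')
        (fqB_basis \<alpha>' \<beta>'))"
    using assms by (intro fqB_expand) (auto simp: fq_coord_fqG split: if_splits)
  then show ?thesis using assms by (simp add: fq_coord_fqG)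
qed

lemma fqB_closed: "fqB f g \<in> fqsym"
  unfolding fqB_def fqB_basis_def fqsym_def Let_def
  by (intro ser.span_sum ser.span_scale ser.span_base) (auto simp: all_perms_def)

lemma fqB_add_left:
  assumes "f \<in> fqsym" "f' \<in> fqsym"
  shows "fqB (f + f') g = fqB f g + fqB f' g"
proof -
  let ?N = "\<lambda>f :: ('a, 'b) series. {\<alpha>. \<alpha> \<in> all_perms \<and> fq_coord f \<alpha> \<noteq> 0}"
  let ?S = "?N f \<union> ?N f' \<union> ?N (f + f')"
  have e: "fqB h g = (\<Sum>\<alpha>\<in>?S. \<Sum>\<beta>\<in>?N g. ser_scale (fq_coord h \<alpha> * fq_coord g \<beta>) (fqB_basis \<alpha> \<beta>))"
    if "h \<in> {f, f', f + f'}" for h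
    using that by (intro fqB_expand) (auto simp: finite_fq_coord)
  show ?thesis
    using assms
    by (simp add: e fq_coord_add distrib_right ser.scale_left_distrib sum.distrib del: plus_fun_apply)
qed

lemma fqB_add_right:
  assumes "g \<in> fqsym" "g' \<in> fqsym"
  shows "fqB f (g + g') = fqB f g + fqB f g'"
proof -
  let ?N = "\<lambda>f :: ('a, 'b) series. {\<alpha>. \<alpha> \<in> all_perms \<and> fq_coord f \<alpha> \<noteq> 0}"
  let ?S = "?N g \<union> ?N g' \<union> ?N (g + g')"
  have e: "fqB f h = (\<Sum>\<alpha>\<in>?N f. \<Sum>\<beta>\<in>?S. ser_scale (fq_coord f \<alpha> * fq_coord h \<beta>) (fqB_basis \<alpha> \<beta>))"
    if "h \<in> {g, g', g + g'}" for h
    using that by (intro fqB_expand) (auto simp: finite_fq_coord)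
  show ?thesis
    using assms
    by (simp add: e fq_coord_add distrib_left ser.scale_left_distrib sum.distrib del: plus_fun_apply)
qed

lemma fqB_scale_left:
  assumes "f \<in> fqsym"
  shows "fqB (ser_scale c f) g = ser_scale c (fqB f g)"
proof -
  let ?N = "\<lambda>f :: ('a, 'b) series. {\<alpha>. \<alpha> \<in> all_perms \<and> fq_coord f \<alpha> \<noteq> 0}"
  let ?S = "?N f \<union> ?N (ser_scale c f)"
  have e: "fqB h g = (\<Sum>\<alpha>\<in>?S. \<Sum>\<beta>\<in>?N g. ser_scale (fq_coord h \<alpha> * fq_coord g \<beta>) (fqB_basis \<alpha> \<beta>))"
    if "h \<in> {f, ser_scale c f}" for h
    using that by (intro fqB_expand) (auto simp: finite_fq_coord)
  show ?thesis
    using assms by (simp add: e fq_coord_scale ser.scale_sum_right mult.assoc)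
qed

lemma fqB_scale_right:
  assumes "g \<in> fqsym"
  shows "fqB f (ser_scale c g) = ser_scale c (fqB f g)"
proof -
  let ?N = "\<lambda>f :: ('a, 'b) series. {\<alpha>. \<alpha> \<in> all_perms \<and> fq_coord f \<alpha> \<noteq> 0}"
  let ?S = "?N g \<union> ?N (ser_scale c g)"
  have e: "fqB f h = (\<Sum>\<alpha>\<in>?N f. \<Sum>\<beta>\<in>?S. ser_scale (fq_coord f \<alpha> * fq_coord h \<beta>) (fqB_basis \<alpha> \<beta>))"
    if "h \<in> {g, ser_scale c g}" for h
    using that by (intro fqB_expand) (auto simp: finite_fq_coord)
  show ?thesis
    using assms by (simp add: e fq_coord_scale ser.scale_sum_right mult.left_commute)
qed

lemma B_tree_closed: "B_tree T \<in> fqsym"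
proof (cases T)
  case CLeaf
  have "(fqG [] :: ('a::{linorder,infinite}, 'b::field) series) \<in> fqsym"
    unfolding fqsym_def
    by (intro ser.span_base imageI) (auto simp: all_perms_def perms_def intro!: exI[of _ 0])
  then show ?thesis using CLeaf by (simp add: fqG_Nil)
qed (simp add: fqB_closed)

end

theory Submission
  imports Defs
begin

text \<open>Standardization of a word with distinct letters is a strictly increasing relabelling, so it
  preserves the shape of the decreasing tree. Cutting a permutation at its maximal letter therefore
  matches the recursion of \<open>B_tree\<close> with that of the decreasing tree. In the functional equation,
  the component of degree \<open>n\<close> of \<open>1 + B(Y, Y)\<close> only involves components of \<open>Y\<close> of degree
  less than \<open>n\<close>, hence uniqueness.\<close>

section \<open>Decreasing trees and standardization\<close>

text \<open>The bound is strict on u and weak on v because \<open>takeWhile\<close> cuts at the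
  first occurrence of the maximum; v may contain further copies of m.\<close>

lemma dec_tree_append:
  assumes "\<forall>x\<in>set u. x < m" "\<forall>x\<in>set v. x \<le> m"
  shows "dec_tree (u @ m # v) = Node (dec_tree u) m (dec_tree v)"
proof -
  have "Max (set (u @ m # v)) = m"
    by (rule Max_eqI) (use assms in \<open>auto intro: less_imp_le\<close>)
  moreover have "x \<noteq> m" if "x \<in> set u" for x
    using assms(1) that by auto
  then have "takeWhile (\<lambda>x. x \<noteq> m) (u @ m # v) = u" "dropWhile (\<lambda>x. x \<noteq> m) (u @ m # v) = m # v"
    by simp_all
  ultimately show ?thesis
    by (subst dec_tree.simps) (simp only: Let_def, simp)
qed

text \<open>Cutting at the first occurrence of the maximum yields exactly the hypotheses of
  \<open>dec_tree_append\<close>, so inductions on length work for all words, repeated letters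
  included.\<close>

lemma split_at_Max:
  fixes w :: "'a::linorder list"
  assumes "w \<noteq> []"
  obtains u m v where "w = u @ m # v" "\<forall>x\<in>set u. x < m" "\<forall>x\<in>set v. x \<le> m"
proof -
  have "Max (set w) \<in> set w" using assms by simp
  then obtain u v where w: "w = u @ Max (set w) # v" "Max (set w) \<notin> set u"
    by (meson split_list_first)
  have le: "x \<le> Max (set w)" if "x \<in> set w" for x using that by simp
  have "set u \<subseteq> set w" "set v \<subseteq> set w"
    by (subst w(1), auto)+
  then show thesis
    using w le by (intro that[of u "Max (set w)" v]) (auto simp: less_le)
qed

lemma dec_tree_Nil [simp]: "dec_tree [] = Leaf"
  by (simp add: dec_tree.simps)

lemma size_dec_tree [simp]: "size (dec_tree w) = length w"
proof (induction w rule: length_induct)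
  case (1 w)
  show ?case
  proof (cases "w = []")
    case False
    then obtain u m v where "w = u @ m # v" "\<forall>x\<in>set u. x < m" "\<forall>x\<in>set v. x \<le> m"
      by (rule split_at_Max)
    with 1 show ?thesis by (simp add: dec_tree_append)
  qed simp
qed

text \<open>A strictly increasing relabelling keeps the maximum at its position, so both words are
  cut at the same place.\<close>

lemma dec_tree_map:
  "strict_mono_on (set w) f \<Longrightarrow> dec_tree (map f w) = map_tree f (dec_tree w)"
proof (induction w rule: length_induct)
  case (1 w)
  show ?case
  proof (cases "w = []")
    case False
    then obtain u m v where w: "w = u @ m # v" and uv: "\<forall>x\<in>set u. x < m" "\<forall>x\<in>set v. x \<le> m"
      by (rule split_at_Max)
    have "strict_mono_on (set u) f" "strict_mono_on (set v) f"
      using "1.prems" by (rule monotone_on_subset, simp add: w subset_iff)+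
    then have "dec_tree (map f u) = map_tree f (dec_tree u)" "dec_tree (map f v) = map_tree f (dec_tree v)"
      using "1.IH" by (simp_all add: w)
    moreover have "\<forall>x\<in>set (map f u). x < f m" "\<forall>x\<in>set (map f v). x \<le> f m"
      using uv "1.prems" by (auto simp: w strict_mono_on_less strict_mono_on_less_eq)
    ultimately show ?thesis
      by (simp add: w dec_tree_append uv)
  qed simp
qed

text \<open>Without repeated letters the tie-breaking by position never applies: the label is the
  rank of the letter. Standardization becomes a \<open>map\<close>, to which
  \<open>dec_tree_map\<close> applies.\<close>

lemma std_distinct:
  assumes "distinct w"
  shows "std w = map (\<lambda>x. 1 + card {y \<in> set w. y < x}) w"
proof (rule nth_equalityI)
  fix i assume "i < length (std w)"
  then have i: "i < length w" by simp
  have "{j. j < length w \<and> (w ! j < w ! i \<or> w ! j = w ! i \<and> j < i)}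
      = {j. j < length w \<and> w ! j < w ! i}" (is "_ = ?A")
    using assms i by (auto simp: nth_eq_iff_index_eq)
  moreover have "card ?A = card ((!) w ` ?A)"
    using assms by (intro card_image[symmetric]) (auto simp: inj_on_def nth_eq_iff_index_eq)
  moreover have "(!) w ` ?A = {x \<in> set w. x < w ! i}"
    by (auto simp: in_set_conv_nth)
  ultimately show "std w ! i = map (\<lambda>x. 1 + card {y \<in> set w. y < x}) w ! i"
    using i by (simp add: std_nth)
qed simp

lemma strict_mono_on_rank:
  fixes S :: "'a::linorder set"
  assumes "finite S"
  shows "strict_mono_on S (\<lambda>x. 1 + card {y \<in> S. y < x})"
  using assms by (intro strict_mono_onI) (auto intro!: psubset_card_mono)

text \<open>The rank map is injective with values in an interval of the right cardinality, hence
  onto it.\<close>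

lemma std_in_perms:
  assumes "distinct w"
  shows "std w \<in> perms (length w)"
proof -
  let ?f = "\<lambda>x. 1 + card {y \<in> set w. y < x}"
  have "inj_on ?f (set w)"
    by (rule strict_mono_on_imp_inj_on[OF strict_mono_on_rank]) simp
  moreover have "?f ` set w = {1..length w}"
  proof (rule card_subset_eq)
    \<comment> \<open>The letter x does not count itself, so the rank, shifted by 1, is still at
      most the length.\<close>
    have "card {y \<in> set w. y < x} < card (set w)" if "x \<in> set w" for x
      using that by (intro psubset_card_mono) auto
    then show "?f ` set w \<subseteq> {1..length w}"
      using assms by (auto simp: distinct_card Suc_le_eq)
    show "card (?f ` set w) = card {1..length w}"
      using card_image[OF \<open>inj_on ?f (set w)\<close>] assms by (simp add: distinct_card)
  qed simp
  ultimately show ?thesis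
    using assms unfolding std_distinct[OF assms] perms_def
    by (intro permutations_of_setI) (simp_all add: distinct_map)
qed

lemma shape_dec_tree_std:
  assumes "distinct w"
  shows "shape (dec_tree (std w)) = shape (dec_tree w)"
  unfolding std_distinct[OF assms] dec_tree_map[OF strict_mono_on_rank[OF finite_set]]
  by (simp add: shape_def tree.map_comp comp_def)

section \<open>Cutting a permutation at its largest letter\<close>

lemma permsD:
  assumes "\<gamma> \<in> perms n"
  shows "distinct \<gamma>" "set \<gamma> = {1..n}" "length \<gamma> = n" "\<gamma> \<in> all_perms"
  using assms length_finite_permutations_of_set[of \<gamma> "{1..n}"]
  by (auto simp: perms_def all_perms_def dest: permutations_of_setD)

lemma finite_perms [simp]: "finite (perms n)"
  by (simp add: perms_def)

text \<open>Since n + 1 occurs only once, u and v are functions of \<gamma>. They are words with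
  distinct letters, in general not permutations, so they enter B only through
  \<open>std\<close>.\<close>

lemma perms_split_max:
  assumes "\<gamma> \<in> perms (n + 1)" "\<gamma> = u @ (n + 1) # v"
  shows "distinct u" "distinct v" "length u + length v = n"
    "takeWhile (\<lambda>x. x \<noteq> n + 1) \<gamma> = u" "tl (dropWhile (\<lambda>x. x \<noteq> n + 1) \<gamma>) = v"
    "shape (dec_tree \<gamma>) = Node (shape (dec_tree u)) () (shape (dec_tree v))"
proof -
  have d: "distinct \<gamma>" "set \<gamma> = {1..n + 1}" "length \<gamma> = n + 1"
    using permsD[OF assms(1)] by simp_all
  show "distinct u" "distinct v" "length u + length v = n"
    using d(1,3) assms(2) by simp_all
  have "n + 1 \<notin> set u" using d(1) assms(2) by simp
  then have ne: "x \<noteq> n + 1" if "x \<in> set u" for x using that by blast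
  then show "takeWhile (\<lambda>x. x \<noteq> n + 1) \<gamma> = u" "tl (dropWhile (\<lambda>x. x \<noteq> n + 1) \<gamma>) = v"
    unfolding assms(2) by simp_all
  have "set u \<subseteq> {1..n + 1}" "set v \<subseteq> {1..n + 1}"
    unfolding d(2)[symmetric] assms(2) by auto
  then have le: "\<forall>x\<in>set u. x \<le> n + 1" "\<forall>x\<in>set v. x \<le> n + 1"
    by (simp_all add: subset_iff)
  with ne have "\<forall>x\<in>set u. x < n + 1"
    by (meson le_neq_implies_less)
  with le(2)
  show "shape (dec_tree \<gamma>) = Node (shape (dec_tree u)) () (shape (dec_tree v))"
    unfolding assms(2) by (simp only: dec_tree_append) (simp add: shape_def)
qed

lemma perms_split_max_ex:
  assumes "\<gamma> \<in> perms (n + 1)"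
  obtains u v where "\<gamma> = u @ (n + 1) # v"
proof -
  have "n + 1 \<in> set \<gamma>" using permsD(2)[OF assms] by simp
  then show thesis using that by (meson split_list)
qed

section \<open>The map B on sums\<close>

lemma fqG_in_fqsym: "\<sigma> \<in> all_perms \<Longrightarrow> fqG \<sigma> \<in> fqsym"
  unfolding fqsym_def by (intro ser.span_base imageI)

lemma sum_in_fqsym: "(\<And>i. i \<in> I \<Longrightarrow> f i \<in> fqsym) \<Longrightarrow> sum f I \<in> fqsym"
  unfolding fqsym_def by (rule ser.span_sum)

lemma zero_in_fqsym: "0 \<in> fqsym"
  unfolding fqsym_def by (rule ser.span_zero)

lemma fqB_zero_left: "fqB 0 g = 0"
  using fqB_scale_left[OF zero_in_fqsym, of 0 g] by simp

lemma fqB_zero_right: "fqB f 0 = 0"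
  using fqB_scale_right[OF zero_in_fqsym, of f 0] by simp

text \<open>Additivity of B rests on additivity of coordinates, which is available inside
  \<open>fqsym\<close>; hence the membership hypothesis. For infinite I both sides are 0.\<close>

lemma fqB_sum_left:
  "(\<And>i. i \<in> I \<Longrightarrow> f i \<in> fqsym) \<Longrightarrow> fqB (sum f I) g = (\<Sum>i\<in>I. fqB (f i) g)"
  by (induction I rule: infinite_finite_induct)
     (simp_all add: fqB_zero_left fqB_add_left sum_in_fqsym del: plus_fun_apply)

lemma fqB_sum_right:
  "(\<And>i. i \<in> I \<Longrightarrow> f i \<in> fqsym) \<Longrightarrow> fqB g (sum f I) = (\<Sum>i\<in>I. fqB g (f i))"
  by (induction I rule: infinite_finite_induct)
     (simp_all add: fqB_zero_right fqB_add_right sum_in_fqsym del: plus_fun_apply)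

lemma fqB_sum_sum:
  assumes "\<And>i. i \<in> I \<Longrightarrow> f i \<in> fqsym" "\<And>j. j \<in> J \<Longrightarrow> g j \<in> fqsym"
  shows "fqB (sum f I) (sum g J) = (\<Sum>(i, j)\<in>I \<times> J. fqB (f i) (g j))"
  by (subst fqB_sum_left) (simp_all add: assms fqB_sum_right sum.cartesian_product)

section \<open>The series of a single tree\<close>

text \<open>Let g cut \<gamma> at its maximum and standardize both factors. Each B(G_\<sigma>,
  G_\<tau>) is the sum of G_\<gamma> over one fibre of g, and the fibres partition the permutations
  of the composite shape.\<close>

lemma fqB_P_tree:
  "fqB (P_tree t) (P_tree t') = (P_tree (Node t () t') :: ('a::{linorder,infinite}, 'k::field) series)"
proof -
  define S where "S t = {\<sigma> \<in> perms (size t). shape (dec_tree \<sigma>) = t}" for t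
  define N where "N = size t + size t'"
  define g where "g \<gamma> = (std (takeWhile (\<lambda>x. x \<noteq> N + 1) \<gamma>), std (tl (dropWhile (\<lambda>x. x \<noteq> N + 1) \<gamma>)))"
    for \<gamma> :: "nat list"
  let ?G = "fqG :: nat list \<Rightarrow> ('a, 'k) series"
  have P: "P_tree t = sum ?G (S t)" for t
    by (simp add: P_tree_def S_def)
  have S_perms: "\<sigma> \<in> all_perms" "length \<sigma> = size t" if "\<sigma> \<in> S t" for \<sigma> t
    using that permsD by (auto simp: S_def)
  have fin: "finite (S t)" for t by (simp add: S_def)
  have std_S: "std u \<in> S (shape (dec_tree u))" if "distinct u" for u :: "nat list"
    using std_in_perms[OF that] shape_dec_tree_std[OF that]
    by (simp add: S_def shape_def)
  \<comment> \<open>Every \<gamma> of the composite shape lies over some pair, so grouping by g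
    loses no term.\<close>
  have gS: "g \<gamma> \<in> S t \<times> S t'" if "\<gamma> \<in> S (Node t () t')" for \<gamma>
  proof -
    have \<gamma>: "\<gamma> \<in> perms (N + 1)" "shape (dec_tree \<gamma>) = Node t () t'"
      using that by (simp_all add: S_def N_def)
    obtain u v where uv: "\<gamma> = u @ (N + 1) # v" using \<gamma>(1) by (rule perms_split_max_ex)
    note s = perms_split_max[OF \<gamma>(1) uv]
    show ?thesis using s(4-6) \<gamma>(2) std_S[OF s(1)] std_S[OF s(2)] by (simp add: g_def)
  qed
  \<comment> \<open>The right-hand side is the index set of \<open>fqB_basis\<close>, which mentions
    no shape; the shape of \<gamma> follows from those of \<sigma> and \<tau>, as \<open>std\<close>
    preserves shapes.\<close>
  have fibre: "{\<gamma> \<in> S (Node t () t'). g \<gamma> = (\<sigma>, \<tau>)}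
      = {\<gamma>. \<gamma> \<in> perms (N + 1) \<and> (\<exists>u v. \<gamma> = u @ [N + 1] @ v \<and> std u = \<sigma> \<and> std v = \<tau>)}"
    if "\<sigma> \<in> S t" "\<tau> \<in> S t'" for \<sigma> \<tau>
  proof (intro Collect_cong iffI; elim conjE exE)
    fix \<gamma> assume \<gamma>: "\<gamma> \<in> S (Node t () t')" "g \<gamma> = (\<sigma>, \<tau>)"
    then have p: "\<gamma> \<in> perms (N + 1)" by (simp add: S_def N_def)
    obtain u v where uv: "\<gamma> = u @ (N + 1) # v" using p by (rule perms_split_max_ex)
    have "std u = \<sigma>" "std v = \<tau>"
      using \<gamma>(2) perms_split_max(4,5)[OF p uv] by (simp_all add: g_def)
    with p uv show "\<gamma> \<in> perms (N + 1) \<and> (\<exists>u v. \<gamma> = u @ [N + 1] @ v \<and> std u = \<sigma> \<and> std v = \<tau>)"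
      by auto
  next
    fix \<gamma> u v assume p: "\<gamma> \<in> perms (N + 1)" and "\<gamma> = u @ [N + 1] @ v"
      and st: "std u = \<sigma>" "std v = \<tau>"
    then have uv: "\<gamma> = u @ (N + 1) # v" by simp
    note s = perms_split_max[OF p uv]
    have "shape (dec_tree u) = t" "shape (dec_tree v) = t'"
      using that st shape_dec_tree_std[OF s(1)] shape_dec_tree_std[OF s(2)] by (auto simp: S_def)
    then show "\<gamma> \<in> S (Node t () t') \<and> g \<gamma> = (\<sigma>, \<tau>)"
      using p s(4-6) st by (simp add: S_def N_def g_def)
  qed
  have "fqB (P_tree t) (P_tree t') = (\<Sum>(\<sigma>, \<tau>)\<in>S t \<times> S t'. fqB (?G \<sigma>) (?G \<tau>))"
    unfolding P by (intro fqB_sum_sum fqG_in_fqsym) (auto dest: S_perms)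
  also have "\<dots> = (\<Sum>p\<in>S t \<times> S t'. sum ?G {\<gamma> \<in> S (Node t () t'). g \<gamma> = p})"
  proof (intro sum.cong refl, clarify)
    fix \<sigma> \<tau> assume st: "\<sigma> \<in> S t" "\<tau> \<in> S t'"
    have "fqB (?G \<sigma>) (?G \<tau>) = fqB_basis \<sigma> \<tau>"
      using st by (intro fqB_fqG) (auto dest: S_perms)
    \<comment> \<open>The lengths of \<sigma> and \<tau> are the sizes of t and t', so the
      \<open>n\<close> in \<open>fqB_basis\<close> is \<open>N\<close>.\<close>
    also have "\<dots> = sum ?G {\<gamma> \<in> S (Node t () t'). g \<gamma> = (\<sigma>, \<tau>)}"
      unfolding fibre[OF st] using st by (simp add: fqB_basis_def Let_def N_def S_perms)
    finally show "fqB (?G \<sigma>) (?G \<tau>) = sum ?G {\<gamma> \<in> S (Node t () t'). g \<gamma> = (\<sigma>, \<tau>)}" .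
  qed
  also have "\<dots> = sum ?G (S (Node t () t'))"
    by (rule sum.group) (use fin gS in \<open>simp_all add: image_subset_iff\<close>)
  finally show ?thesis by (simp add: P)
qed

lemma P_tree_Leaf: "P_tree Leaf = ser_one"
proof -
  have "{\<sigma>. \<sigma> \<in> perms 0 \<and> shape (dec_tree \<sigma>) = Leaf} = {[]}"
    by (auto simp: perms_def shape_def)
  then show ?thesis by (simp add: P_tree_def fqG_Nil)
qed

text \<open>\<open>P_tree_Leaf\<close> and \<open>fqB_P_tree\<close> are the two clauses of the
  recursion defining \<open>B_tree\<close>.\<close>

lemma B_tree_eq_P_tree: "B_tree T = P_tree (delete_leaves T)"
  by (induction T) (simp_all add: P_tree_Leaf fqB_P_tree)

lemma size_delete_leaves: "size (delete_leaves T) = internal_nodes T"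
  by (induction T) simp_all

text \<open>Visible from the expansion in the G's: each \<open>fqG \<sigma>\<close> is supported on
  words as long as \<sigma>.\<close>

lemma B_tree_homogeneous:
  assumes "length w \<noteq> internal_nodes T"
  shows "B_tree T w = 0"
proof -
  have "fqG \<sigma> w = 0" if "\<sigma> \<in> perms (internal_nodes T)" for \<sigma>
    using permsD(3)[OF that] assms by (simp add: fqG_def)
  then show ?thesis
    by (auto simp: B_tree_eq_P_tree P_tree_def size_delete_leaves sum_fun_apply intro!: sum.neutral)
qed

section \<open>The functional equation\<close>

text \<open>The bound is an inequality because the subtrees of a tree with n + 1 internal nodes can
  have any number of them up to n.\<close>

lemma finite_internal_nodes_le: "finite {T. internal_nodes T \<le> n}"
proof (induction n)
  case 0
  have "{T. internal_nodes T \<le> 0} \<subseteq> {CLeaf}"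
  proof
    fix T show "T \<in> {T. internal_nodes T \<le> 0} \<Longrightarrow> T \<in> {CLeaf}" by (cases T) auto
  qed
  then show ?case by (rule finite_subset) simp
next
  case (Suc n)
  let ?F = "{T. internal_nodes T \<le> n}"
  have "{T. internal_nodes T \<le> Suc n} \<subseteq> insert CLeaf (case_prod CNode ` (?F \<times> ?F))"
  proof
    fix T assume "T \<in> {T. internal_nodes T \<le> Suc n}"
    then show "T \<in> insert CLeaf (case_prod CNode ` (?F \<times> ?F))" by (cases T) auto
  qed
  then show ?case by (rule finite_subset) (use Suc in simp)
qed

lemma finite_internal_nodes: "finite {T. internal_nodes T = n}"
  by (rule finite_subset[OF _ finite_internal_nodes_le[of n]]) auto

text \<open>\<open>Sum_any\<close> is 0 by default on infinite support; homogeneity confines the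
  support to a finite set of trees, so the sum is the intended one.\<close>

lemma X_series_apply:
  "X_series w = (\<Sum>T | internal_nodes T = length w. B_tree T w)"
proof -
  have "{T. B_tree T w \<noteq> 0} \<subseteq> {T. internal_nodes T = length w}"
    by (intro Collect_mono impI) (metis B_tree_homogeneous)
  then show ?thesis
    unfolding X_series_def by (rule Sum_any.expand_superset[OF finite_internal_nodes])
qed

text \<open>Each component of X is thus a finite sum in \<open>fqsym\<close>, to which
  \<open>fqB_sum_sum\<close> applies.\<close>

lemma ser_hom_X_series:
  "ser_hom n X_series = (\<Sum>T | internal_nodes T = n. B_tree T)"
proof
  fix w
  show "ser_hom n X_series w = (\<Sum>T | internal_nodes T = n. B_tree T) w"
    unfolding ser_hom_def sum_fun_apply
    by (auto simp: X_series_apply B_tree_homogeneous intro!: sum.neutral[symmetric])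
qed

lemma X_series_in_completion: "X_series \<in> fqsym_completion"
  unfolding fqsym_completion_def
  by (auto simp: ser_hom_X_series intro: sum_in_fqsym B_tree_closed)

section \<open>X solves the equation\<close>

lemma finite_sum_pairs: "finite {(k, l). k + l + 1 = (n::nat)}"
  by (rule finite_subset[of _ "{..n} \<times> {..n}"]) auto

lemma internal_nodes_eq_0_iff: "internal_nodes T = 0 \<longleftrightarrow> T = CLeaf"
  by (cases T) auto

text \<open>Bilinear expansion gives a sum over pairs of subtrees. \<open>CNode\<close> maps these
  pairs bijectively to the trees other than \<open>CLeaf\<close>, and \<open>CLeaf\<close> accounts
  for \<open>ser_one\<close>.\<close>

lemma X_series_equation:
  "(X_series :: ('a::{linorder,infinite}, 'k::field) series) = ser_one + fqB_completion X_series X_series"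
  (is "?X = _")
proof
  fix w :: "'a list"
  let ?K = "{(k, l). k + l + 1 = length w}"
  define I where "I k = {T. internal_nodes T = k}" for k
  have fin: "finite (I k)" for k by (simp add: I_def finite_internal_nodes)
  have inj: "inj_on (case_prod CNode) A" for A
    by (auto simp: inj_on_def)
  let ?B = "\<lambda>T. B_tree T w :: 'k"
  have "fqB_completion ?X ?X w
      = (\<Sum>(k, l)\<in>?K. fqB (sum B_tree (I k)) (sum B_tree (I l)) w)"
    by (simp add: fqB_completion_def ser_hom_X_series I_def)
  also have "\<dots> = (\<Sum>(k, l)\<in>?K. \<Sum>p\<in>I k \<times> I l. ?B (case_prod CNode p))"
    by (intro sum.cong refl)
       (auto simp: fqB_sum_sum B_tree_closed sum_fun_apply intro!: sum.cong)
  also have "\<dots> = (\<Sum>q\<in>?K. \<Sum>p\<in>I (fst q) \<times> I (snd q). ?B (case_prod CNode p))"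
    by (simp add: case_prod_beta)
  \<comment> \<open>The blocks are disjoint: the node counts of a pair of trees determine q.\<close>
  also have "\<dots> = (\<Sum>p\<in>(\<Union>q\<in>?K. I (fst q) \<times> I (snd q)). ?B (case_prod CNode p))"
    by (rule sum.UNION_disjoint[OF finite_sum_pairs, symmetric]) (use fin in \<open>auto simp: I_def\<close>)
  also have "\<dots> = (\<Sum>T\<in>case_prod CNode ` (\<Union>q\<in>?K. I (fst q) \<times> I (snd q)). ?B T)"
    by (simp only: sum.reindex[OF inj] comp_def)
  \<comment> \<open>The 1 in k + l + 1 is the root added by \<open>CNode\<close>.\<close>
  also have "case_prod CNode ` (\<Union>q\<in>?K. I (fst q) \<times> I (snd q)) = I (length w) - {CLeaf}"
  proof (intro set_eqI)
    fix T
    show "T \<in> case_prod CNode ` (\<Union>q\<in>?K. I (fst q) \<times> I (snd q)) \<longleftrightarrow> T \<in> I (length w) - {CLeaf}"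
      by (cases T) (auto simp: I_def image_iff)
  qed
  finally have B: "fqB_completion ?X ?X w = sum ?B (I (length w) - {CLeaf})" .
  have "?X w = sum ?B (I (length w))"
    by (simp add: X_series_apply I_def)
  also have "\<dots> = ser_one w + sum ?B (I (length w) - {CLeaf})"
  \<comment> \<open>\<open>CLeaf\<close> has degree 0: it contributes only at the empty word, where
    it is the only tree.\<close>
  proof (cases "w = []")
    case True
    then show ?thesis by (simp add: I_def internal_nodes_eq_0_iff)
  next
    case False
    then have "CLeaf \<notin> I (length w)" by (simp add: I_def)
    with False show ?thesis by (simp add: ser_one_def)
  qed
  finally show "?X w = (ser_one + fqB_completion ?X ?X) w"
    by (simp add: B)
qed

section \<open>Uniqueness of the solution\<close>

lemma ser_hom_equation:
  assumes "Y = ser_one + fqB_completion Y Y"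
  shows "ser_hom n Y = (\<lambda>w. if length w = n
    then ser_one w + (\<Sum>(k, l) | k + l + 1 = n. fqB (ser_hom k Y) (ser_hom l Y) w) else 0)"
proof
  fix w
  have "Y w = ser_one w + fqB_completion Y Y w"
    by (subst assms) simp
  then show "ser_hom n Y w = (if length w = n
    then ser_one w + (\<Sum>(k, l) | k + l + 1 = n. fqB (ser_hom k Y) (ser_hom l Y) w) else 0)"
    by (auto simp: ser_hom_def fqB_completion_def)
qed

lemma equation_unique:
  fixes Y Z :: "('a::{linorder,infinite}, 'k::field) series"
  assumes Y: "Y = ser_one + fqB_completion Y Y" and Z: "Z = ser_one + fqB_completion Z Z"
  shows "Y = Z"
proof -
  have "ser_hom n Y = ser_hom n Z" for n
  proof (induction n rule: less_induct)
    case (less n)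
    have "(\<Sum>(k, l) | k + l + 1 = n. fqB (ser_hom k Y) (ser_hom l Y) w)
        = (\<Sum>(k, l) | k + l + 1 = n. fqB (ser_hom k Z) (ser_hom l Z) w)" for w
      \<comment> \<open>k + l + 1 = n forces k < n and l < n, so the induction hypothesis covers
        both arguments.\<close>
      by (intro sum.cong refl) (auto simp: less)
    then show ?case
      by (simp only: ser_hom_equation[OF Y, of n] ser_hom_equation[OF Z, of n])
  qed
  \<comment> \<open>The coefficient at w is read off from the component of degree
    \<open>length w\<close>.\<close>
  then have "ser_hom (length w) Y w = ser_hom (length w) Z w" for w by simp
  then show ?thesis by (simp add: ser_hom_def fun_eq_iff)
qed

theorem theorem2p2:
  shows
    "(\<forall>T n. internal_nodes T = n \<longrightarrow>
        (B_tree T :: ('a::{linorder,infinite}, 'k::field_char_0) series)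
          = (\<Sum>\<sigma> | \<sigma> \<in> perms n \<and> shape (dec_tree \<sigma>) = delete_leaves T. fqG \<sigma>) \<and>
        (B_tree T :: ('a, 'k) series) = P_tree (delete_leaves T)) \<and>
     (X_series :: ('a, 'k) series) \<in> fqsym_completion \<and>
     (X_series :: ('a, 'k) series) = ser_one + fqB_completion X_series X_series \<and>
     (\<forall>Y :: ('a, 'k) series. Y \<in> fqsym_completion \<and> Y = ser_one + fqB_completion Y Y
        \<longrightarrow> Y = X_series)"
proof (intro conjI allI impI)
  fix T n assume "internal_nodes T = n"
  then show "(B_tree T :: ('a, 'k) series)
      = (\<Sum>\<sigma> | \<sigma> \<in> perms n \<and> shape (dec_tree \<sigma>) = delete_leaves T. fqG \<sigma>)"
    by (simp add: B_tree_eq_P_tree P_tree_def size_delete_leaves)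
next
  fix Y :: "('a, 'k) series"
  assume "Y \<in> fqsym_completion \<and> Y = ser_one + fqB_completion Y Y"
  then show "Y = X_series" by (elim conjE equation_unique[OF _ X_series_equation])
qed (rule B_tree_eq_P_tree X_series_in_completion X_series_equation)+

end
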